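(* Let $k$ and $n$ be positive integers such that $2 \leq k \leq n+1$, and let $m$ be an integer with $1 \leq m \leq 2^n$. Then the number of $k$-chains in a union-closed family with universe $[n]$ and size $m$ is minimized whenever the family is top-aligned; that is, if $\mathcal{T}$ is a top-aligned union-closed family with universe $[n]$ and $|\mathcal{T}|=m$, then for every union-closed family $\mathcal{A}$ with universe $[n]$ and $|\mathcal{A}|=m$, the number of $k$-chains in $\mathcal{T}$ is at most the number of $k$-chains in $\mathcal{A}$. Further, if the minimum number of $k$-chains over all union-closed families with universe $[n]$ and size $m$ is nonzero and $m>n$, then there are no other minimizing families; that is, every union-closed family with universe $[n]$ and size $m$ whose number of $k$-chains equals this minimum is top-aligned.
   Context: Write $[n]=\{1,\ldots,n\}$ and $2^{[n]}=\{X : X\subseteq [n]\}$. A family $\mathcal{A}$ is a finite family of distinct finite sets, at least one of which is nonempty (the empty set may be a member); its size is $|\mathcal{A}|$, and its universe is $U(\mathcal{A})=\bigcup_{A\in\mathcal{A}}A$. A family $\mathcal{A}$ is union-closed if $X_1,X_2\in\mathcal{A}$ implies $X_1\cup X_2\in\mathcal{A}$. A chain in $\mathcal{A}$ is a subfamily $\mathcal{C}\subseteq\mathcal{A}$ such that for all $X_1,X_2\in\mathcal{C}$, $X_1\subseteq X_2$ or $X_2\subseteq X_1$; a $k$-chain is a chain consisting of exactly $k$ distinct sets. A family $\mathcal{A}$ with universe $[n]$ is top-aligned if $|A_1|\geq|A_2|$ for all $A_1\in\mathcal{A}$ and all $A_2\in 2^{[n]}\setminus\mathcal{A}$. *)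

theory Defs
  imports Main
begin

definition is_family :: "'a set set \<Rightarrow> bool" where
  "is_family \<A> \<longleftrightarrow> finite \<A> \<and> (\<forall>A\<in>\<A>. finite A) \<and> (\<exists>A\<in>\<A>. A \<noteq> {})"

definition union_closed :: "'a set set \<Rightarrow> bool" where
  "union_closed \<A> \<longleftrightarrow> (\<forall>X\<in>\<A>. \<forall>Y\<in>\<A>. X \<union> Y \<in> \<A>)"

definition uc_families :: "nat \<Rightarrow> nat \<Rightarrow> nat set set set" where
  "uc_families n m =
    {\<A>. is_family \<A> \<and> union_closed \<A> \<and> \<Union>\<A> = {1..n} \<and> card \<A> = m}"

text \<open>The library's \<^const>\<open>chains\<close> is the set of subfamilies that are totally ordered by inclusion.\<close>

definition k_chains :: "nat \<Rightarrow> 'a set set \<Rightarrow> 'a set set set" where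
  "k_chains k \<A> = {\<C> \<in> chains \<A>. finite \<C> \<and> card \<C> = k}"

definition top_aligned :: "nat \<Rightarrow> nat set set \<Rightarrow> bool" where
  "top_aligned n \<A> \<longleftrightarrow> is_family \<A> \<and> \<Union>\<A> = {1..n} \<and>
    (\<forall>A\<^sub>1\<in>\<A>. \<forall>A\<^sub>2\<in>Pow {1..n} - \<A>. card A\<^sub>1 \<ge> card A\<^sub>2)"

text \<open>For \<open>n \<ge> 1\<close> and \<open>1 \<le> m \<le> 2 ^ n\<close> the set of counts is finite and nonempty, so \<^const>\<open>Min\<close>
  is its least element.\<close>

definition min_k_chains :: "nat \<Rightarrow> nat \<Rightarrow> nat \<Rightarrow> nat" where
  "min_k_chains k n m = Min ((\<lambda>\<A>. card (k_chains k \<A>)) ` uc_families n m)"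

end

theory Submission
  imports Defs
begin

text \<open>Removing a minimal member \<open>A\<close> from a union-closed family destroys exactly the \<open>k\<close>-chains
  consisting of \<open>A\<close> and a \<open>(k - 1)\<close>-chain above it. In a top-aligned family with smallest member of
  size \<open>n - d\<close>, the part above that member is a full interval, a cube of dimension \<open>d\<close>. Any other
  union-closed family of the same size has more members than there are sets of size greater than
  \<open>n - d\<close>, so by Sauer--Shelah it shatters a \<open>d\<close>-set; unions of members realising the singleton
  traces, together with a minimal member \<open>A\<close> of empty trace, form a \<open>d\<close>-dimensional cube with bottom
  \<open>A\<close>. So \<open>A\<close> has at least as many chains above it, and the inequality follows by induction on the
  size. For uniqueness the same induction leaves two situations: removing \<open>A\<close> may give a top-aligned
  family, in which case \<open>A\<close> is too small and has strictly more chains above it; or it may give a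
  family with no long chain at all, which is then the extremal family of Sauer--Shelah and hence
  consists of the top levels.\<close>

section \<open>Chains: removal of a minimal member, embeddings, and ranks\<close>

lemma k_chains_iff:
  "C \<in> k_chains k F \<longleftrightarrow>
     C \<subseteq> F \<and> (\<forall>X\<in>C. \<forall>Y\<in>C. X \<subseteq> Y \<or> Y \<subseteq> X) \<and> finite C \<and> card C = k"
  by (auto simp: k_chains_def chains_def chain_subset_def)

lemma finite_k_chains: "finite F \<Longrightarrow> finite (k_chains k F)"
  by (rule finite_subset[of _ "Pow F"]) (auto simp: k_chains_iff)

text \<open>The chains are split by whether they contain \<open>A\<close>. The other members of a
  chain through \<open>A\<close> are comparable to \<open>A\<close>, hence strictly above it by
  minimality, and deleting \<open>A\<close> is injective on such chains.\<close>

lemma card_k_chains_remove_minimal: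
  assumes "finite F" "A \<in> F" and minimal: "\<forall>B\<in>F. \<not> B \<subset> A"
  shows "card (k_chains (Suc j) F) =
    card (k_chains (Suc j) (F - {A})) + card (k_chains j {X \<in> F. A \<subset> X})"
proof -
  let ?G = "{X \<in> F. A \<subset> X}"
  have inj: "inj_on (insert A) (k_chains j ?G)"
  proof (rule inj_onI)
    fix C C' assume "C \<in> k_chains j ?G" "C' \<in> k_chains j ?G" and eq: "insert A C = insert A C'"
    then have "A \<notin> C" "A \<notin> C'" by (auto simp: k_chains_iff)
    with eq show "C = C'" by (metis insert_ident)
  qed
  have eq: "k_chains (Suc j) F = k_chains (Suc j) (F - {A}) \<union> insert A ` k_chains j ?G"
  proof (intro equalityI subsetI)
    fix C assume C: "C \<in> k_chains (Suc j) F"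
    show "C \<in> k_chains (Suc j) (F - {A}) \<union> insert A ` k_chains j ?G"
    proof (cases "A \<in> C")
      case True
      have "X \<in> ?G" if "X \<in> C - {A}" for X
        using that C True minimal unfolding k_chains_iff
        by (metis (mono_tags, lifting) Diff_iff insertI1 mem_Collect_eq psubsetI subsetD)
      then have "C - {A} \<subseteq> ?G" by blast
      moreover have "card (C - {A}) = j" using C True by (simp add: k_chains_iff)
      ultimately have "C - {A} \<in> k_chains j ?G"
        using C unfolding k_chains_iff by (metis Diff_iff finite_Diff)
      moreover have "C = insert A (C - {A})" using True by auto
      ultimately show ?thesis by blast
    next
      case False
      with C show ?thesis by (auto simp: k_chains_iff)
    qed
  next
    fix C assume "C \<in> k_chains (Suc j) (F - {A}) \<union> insert A ` k_chains j ?G"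
    then show "C \<in> k_chains (Suc j) F"
    proof
      assume "C \<in> insert A ` k_chains j ?G"
      then obtain C' where C': "C' \<in> k_chains j ?G" "C = insert A C'" by blast
      then have "A \<notin> C'" by (auto simp: k_chains_iff)
      with C' \<open>A \<in> F\<close> show ?thesis unfolding k_chains_iff by auto
    qed (auto simp: k_chains_iff)
  qed
  have "k_chains (Suc j) (F - {A}) \<inter> insert A ` k_chains j ?G = {}"
    by (auto simp: k_chains_iff)
  then show ?thesis
    unfolding eq using \<open>finite F\<close>
    by (subst card_Un_disjoint) (auto simp: finite_k_chains card_image[OF inj])
qed

text \<open>A union equal to \<open>A\<close> has both its parts inside \<open>A\<close>, and
  minimality makes both of them equal to \<open>A\<close>.\<close>

lemma union_closed_remove_minimal:
  assumes "union_closed F" "\<forall>B\<in>F. \<not> B \<subset> A"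
  shows "union_closed (F - {A})"
  unfolding union_closed_def
proof (intro ballI)
  fix X Y assume "X \<in> F - {A}" "Y \<in> F - {A}"
  then show "X \<union> Y \<in> F - {A}"
    using assms unfolding union_closed_def by (metis Diff_iff Un_upper1 psubsetI singletonD singletonI)
qed

lemma image_k_chain:
  assumes "\<And>X. X \<in> F \<Longrightarrow> f X \<in> G" "\<And>X Y. \<lbrakk>X \<in> F; Y \<in> F; X \<subset> Y\<rbrakk> \<Longrightarrow> f X \<subset> f Y"
    and "inj_on f F" and C: "C \<in> k_chains j F"
  shows "f ` C \<in> k_chains j G"
proof -
  have CF: "C \<subseteq> F" using C by (simp add: k_chains_iff)
  have "f X \<subseteq> f Y \<or> f Y \<subseteq> f X" if "X \<in> C" "Y \<in> C" for X Y
    using that C CF assms(2)[of X Y] assms(2)[of Y X] unfolding k_chains_iff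
    by (metis psubsetI psubset_imp_subset subset_iff)
  moreover have "card (f ` C) = card C"
    using CF \<open>inj_on f F\<close> by (metis card_image inj_on_subset)
  ultimately show ?thesis using C CF assms(1) unfolding k_chains_iff by auto
qed

text \<open>Taking images under \<open>f\<close> sends chains injectively to chains of the same
  length. A chain in \<open>G\<close> that leaves the range of \<open>f\<close> is not hit, which
  makes the comparison strict.\<close>

lemma card_k_chains_embedding:
  assumes "finite G" "\<And>X. X \<in> F \<Longrightarrow> f X \<in> G"
    and "\<And>X Y. \<lbrakk>X \<in> F; Y \<in> F; X \<subset> Y\<rbrakk> \<Longrightarrow> f X \<subset> f Y" and inj: "inj_on f F"
  shows "card (k_chains j F) \<le> card (k_chains j G)"
    and "\<lbrakk>C \<in> k_chains j G; \<not> C \<subseteq> f ` F\<rbrakk> \<Longrightarrow> card (k_chains j F) < card (k_chains j G)"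
proof -
  have sub: "(`) f ` k_chains j F \<subseteq> k_chains j G"
    using image_k_chain[OF assms(2-4)] by blast
  have "inj_on ((`) f) (k_chains j F)"
    by (rule inj_on_subset[OF inj_on_image_Pow[OF inj]]) (auto simp: k_chains_iff)
  then have card: "card ((`) f ` k_chains j F) = card (k_chains j F)"
    by (rule card_image)
  show "card (k_chains j F) \<le> card (k_chains j G)"
    using card_mono[OF finite_k_chains[OF \<open>finite G\<close>] sub] card by simp
  assume "C \<in> k_chains j G" "\<not> C \<subseteq> f ` F"
  moreover have "C \<notin> (`) f ` k_chains j F"
    using \<open>\<not> C \<subseteq> f ` F\<close> unfolding k_chains_iff by (metis imageE image_mono k_chains_iff)
  ultimately have "(`) f ` k_chains j F \<subset> k_chains j G" using sub by blast
  then show "card (k_chains j F) < card (k_chains j G)"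
    using psubset_card_mono[OF finite_k_chains[OF \<open>finite G\<close>]] card by metis
qed

text \<open>\<open>rank_ge F i X\<close>: some chain in \<open>F\<close> with \<open>i + 1\<close> members has greatest member \<open>X\<close>.\<close>

fun rank_ge :: "'a set set \<Rightarrow> nat \<Rightarrow> 'a set \<Rightarrow> bool" where
  "rank_ge F 0 X \<longleftrightarrow> X \<in> F"
| "rank_ge F (Suc i) X \<longleftrightarrow> X \<in> F \<and> (\<exists>Y. Y \<subset> X \<and> rank_ge F i Y)"

lemma rank_ge_mem: "rank_ge F i X \<Longrightarrow> X \<in> F"
  by (cases i) auto

lemma rank_ge_mono: "rank_ge F i X \<Longrightarrow> F \<subseteq> G \<Longrightarrow> rank_ge G i X"
  by (induction i arbitrary: X) auto

lemma rank_ge_le: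
  assumes "rank_ge F i X" "i' \<le> i"
  shows "\<exists>Y. rank_ge F i' Y"
  using assms
proof (induction i arbitrary: X)
  case (Suc i)
  then show ?case by (cases "i' = Suc i") auto
qed auto

lemma rank_ge_imp_chain:
  "rank_ge F i X \<Longrightarrow> \<exists>C\<in>k_chains (Suc i) F. X \<in> C \<and> (\<forall>Z\<in>C. Z \<subseteq> X)"
proof (induction i arbitrary: X)
  case 0
  then show ?case by (intro bexI[of _ "{X}"]) (auto simp: k_chains_iff)
next
  case (Suc i)
  then obtain Y C where "X \<in> F" "Y \<subset> X" and C: "C \<in> k_chains (Suc i) F" "\<forall>Z\<in>C. Z \<subseteq> Y"
    by (meson rank_ge.simps(2))
  then have "X \<notin> C" "\<forall>Z\<in>C. Z \<subseteq> X" by auto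
  with C \<open>X \<in> F\<close> have "insert X C \<in> k_chains (Suc (Suc i)) F"
    unfolding k_chains_iff by auto
  with \<open>\<forall>Z\<in>C. Z \<subseteq> X\<close> show ?case by blast
qed

text \<open>Deleting the \<open>i\<close> points of \<open>W - X\<close> one at a time descends from
  \<open>W\<close> to \<open>X\<close> inside \<open>F\<close>.\<close>

lemma rank_ge_interval:
  assumes "finite W" "X \<subseteq> W" "card W = card X + i" "\<And>S. \<lbrakk>X \<subseteq> S; S \<subseteq> W\<rbrakk> \<Longrightarrow> S \<in> F"
  shows "rank_ge F i W"
  using assms
proof (induction i arbitrary: W)
  case (Suc i)
  then have "X \<noteq> W" by auto
  with Suc.prems obtain w where w: "w \<in> W" "w \<notin> X" by blast
  have "rank_ge F i (W - {w})"
    using Suc.prems w by (intro Suc.IH) auto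
  moreover have "W - {w} \<subset> W" using w by auto
  ultimately show ?case using Suc.prems by auto
qed auto

section \<open>Upper levels and splitting off a point\<close>

text \<open>For finite \<open>U\<close> these are the subsets missing fewer than \<open>d\<close>
  points, so there are none for \<open>d = 0\<close>; their number is the Sauer--Shelah bound, the
  sum of the binomial coefficients of \<open>card U\<close> over \<open>i < d\<close>. The additive
  form avoids truncated subtraction.\<close>

definition upper_levels :: "'a set \<Rightarrow> nat \<Rightarrow> 'a set set" where
  "upper_levels U d = {X. X \<subseteq> U \<and> card U < card X + d}"

text \<open>Together with \<open>doubled\<close> this is the usual decomposition for induction on
  the ground set: \<open>doubled x F\<close> collects the traces that arise from two members of
  \<open>F\<close>.\<close>

definition trace_off :: "'a \<Rightarrow> 'a set set \<Rightarrow> 'a set set" where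
  "trace_off x F = (\<lambda>X. X - {x}) ` F"

definition doubled :: "'a \<Rightarrow> 'a set set \<Rightarrow> 'a set set" where
  "doubled x F = {X \<in> F. x \<notin> X \<and> insert x X \<in> F}"

text \<open>Deleting \<open>x\<close> is injective on the members containing \<open>x\<close>. The
  image and the members avoiding \<open>x\<close> have the trace as their union and the doubled
  family as their intersection.\<close>

lemma card_trace_doubled:
  assumes "finite F"
  shows "card F = card (trace_off x F) + card (doubled x F)"
proof -
  let ?P = "{X \<in> F. x \<in> X}" and ?N = "{X \<in> F. x \<notin> X}"
  let ?f = "\<lambda>X. X - {x}"
  have inj: "inj_on ?f ?P" by (rule inj_onI) (metis (mono_tags, lifting) insert_Diff mem_Collect_eq)
  have "F = ?P \<union> ?N" by auto
  then have "card F = card ?P + card ?N"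
    using assms by (subst (1) \<open>F = ?P \<union> ?N\<close>, subst card_Un_disjoint) auto
  also have "\<dots> = card (?f ` ?P) + card ?N" by (simp add: card_image[OF inj])
  also have "\<dots> = card (?f ` ?P \<union> ?N) + card (?f ` ?P \<inter> ?N)"
    using assms by (intro card_Un_Int) auto
  also have "?f ` ?P \<union> ?N = trace_off x F"
    unfolding trace_off_def
  proof (intro equalityI subsetI)
    fix Y assume "Y \<in> (\<lambda>X. X - {x}) ` F"
    then obtain X where "X \<in> F" "Y = X - {x}" by blast
    then show "Y \<in> ?f ` ?P \<union> ?N" by (cases "x \<in> X") auto
  next
    fix Y assume "Y \<in> ?f ` ?P \<union> ?N"
    then show "Y \<in> (\<lambda>X. X - {x}) ` F"
    proof
      assume "Y \<in> ?N"
      then have "Y \<in> F" "Y = Y - {x}" by auto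
      then show ?thesis by blast
    qed blast
  qed
  also have "?f ` ?P \<inter> ?N = doubled x F"
    unfolding doubled_def
  proof (intro equalityI subsetI)
    fix X assume "X \<in> {X \<in> F. x \<notin> X \<and> insert x X \<in> F}"
    then have "insert x X \<in> ?P" "X \<in> ?N" "X = ?f (insert x X)" by auto
    then show "X \<in> ?f ` ?P \<inter> ?N" by blast
  qed (auto simp: insert_absorb)
  finally show ?thesis .
qed

lemma finite_upper_levels: "finite U \<Longrightarrow> finite (upper_levels U d)"
  by (rule finite_subset[of _ "Pow U"]) (auto simp: upper_levels_def)

lemma upper_levels_mono: "d \<le> d' \<Longrightarrow> upper_levels U d \<subseteq> upper_levels U d'"
  by (auto simp: upper_levels_def)

text \<open>Pascal's rule, read off by splitting the upper levels themselves at
  \<open>x\<close>.\<close>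

lemma card_upper_levels_insert:
  assumes "finite U" "x \<notin> U"
  shows "card (upper_levels (insert x U) (Suc d)) =
    card (upper_levels U (Suc d)) + card (upper_levels U d)"
proof -
  let ?F = "upper_levels (insert x U) (Suc d)"
  have "trace_off x ?F = upper_levels U (Suc d)"
  proof (intro equalityI subsetI)
    fix X assume "X \<in> trace_off x ?F"
    then obtain Z where Z: "Z \<in> ?F" "X = Z - {x}" by (auto simp: trace_off_def)
    then have "finite Z" using assms finite_subset by (fastforce simp: upper_levels_def)
    then have "card Z \<le> card X + 1" using Z card_Diff1_le[of Z x]
      by (cases "x \<in> Z") (auto simp: card_Diff_singleton)
    then show "X \<in> upper_levels U (Suc d)" using Z assms by (auto simp: upper_levels_def)
  next
    fix X assume X: "X \<in> upper_levels U (Suc d)"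
    then have "finite X" "x \<notin> X" using assms finite_subset by (auto simp: upper_levels_def)
    then have "insert x X \<in> ?F" "X = insert x X - {x}"
      using X assms by (auto simp: upper_levels_def)
    then show "X \<in> trace_off x ?F" by (auto simp: trace_off_def)
  qed
  moreover have "doubled x ?F = upper_levels U d"
  proof (intro equalityI subsetI)
    fix X assume "X \<in> doubled x ?F"
    then show "X \<in> upper_levels U d"
      using assms by (auto simp: doubled_def upper_levels_def)
  next
    fix X assume X: "X \<in> upper_levels U d"
    then have "finite X" "x \<notin> X" using assms finite_subset by (auto simp: upper_levels_def)
    then show "X \<in> doubled x ?F"
      using X assms by (auto simp: doubled_def upper_levels_def)
  qed
  ultimately show ?thesis
    using card_trace_doubled[OF finite_upper_levels, of "insert x U" "Suc d" x] assms by simp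
qed

lemma upper_levels_2:
  assumes "finite U"
  shows "upper_levels U 2 = insert U ((\<lambda>x. U - {x}) ` U)"
proof (intro equalityI subsetI)
  fix X assume X: "X \<in> upper_levels U 2"
  then have "X \<subseteq> U" "card (U - X) \<le> 1"
    using assms finite_subset[of X U] by (auto simp: upper_levels_def card_Diff_subset)
  show "X \<in> insert U ((\<lambda>x. U - {x}) ` U)"
  proof (cases "U - X = {}")
    case True
    then show ?thesis using \<open>X \<subseteq> U\<close> by auto
  next
    case False
    then have "card (U - X) = 1"
      using \<open>card (U - X) \<le> 1\<close> assms by (metis One_nat_def card_0_eq finite_Diff le_Suc_eq le_zero_eq)
    then obtain x where "U - X = {x}" by (auto simp: card_1_singleton_iff)
    then have "x \<in> U" "X = U - {x}" using \<open>X \<subseteq> U\<close> by auto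
    then show ?thesis by blast
  qed
qed (use assms in \<open>auto simp: upper_levels_def\<close>)

lemma card_upper_levels_2: "finite U \<Longrightarrow> card (upper_levels U 2) = card U + 1"
  by (subst upper_levels_2, assumption, subst card_insert_disjoint)
     (auto intro!: card_image inj_onI)

section \<open>Shattering in union-closed families\<close>

definition shatters :: "'a set set \<Rightarrow> 'a set \<Rightarrow> bool" where
  "shatters F D \<longleftrightarrow> (\<forall>S\<subseteq>D. \<exists>X\<in>F. X \<inter> D = S)"

text \<open>By Pascal's rule one of the two split families exceeds its own bound. A set shattered by
  the trace is shattered by \<open>F\<close>; a set shattered by the doubled family stays shattered
  after adding \<open>x\<close>, which supplies the missing element.\<close>

lemma sauer_shelah:
  assumes "finite U" "F \<subseteq> Pow U" "card (upper_levels U d) < card F"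
  shows "\<exists>D\<subseteq>U. card D = d \<and> shatters F D"
  using assms
proof (induction U arbitrary: F d rule: finite_induct)
  case empty
  then have "finite F" "F \<noteq> {}" using finite_subset by fastforce+
  then have F: "F = {{}}" using empty.prems(1) by auto
  then have "d = 0" using empty by (cases d) (auto simp: upper_levels_def)
  with F show ?case by (auto simp: shatters_def)
next
  case (insert x U)
  have "finite F" using insert.prems insert.hyps by (meson finite.insertI finite_Pow_iff finite_subset)
  show ?case
  proof (cases d)
    case 0
    have "F \<noteq> {}" using insert.prems by auto
    then show ?thesis using 0 by (intro exI[of _ "{}"]) (auto simp: shatters_def)
  next
    case (Suc e)
    have "card (upper_levels U (Suc e)) < card (trace_off x F) \<or>
          card (upper_levels U e) < card (doubled x F)"
      using insert.prems(2)[unfolded Suc] card_trace_doubled[OF \<open>finite F\<close>, of x]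
        card_upper_levels_insert[OF insert.hyps(1,2), of e] by linarith
    then show ?thesis
    proof
      assume "card (upper_levels U (Suc e)) < card (trace_off x F)"
      moreover have "trace_off x F \<subseteq> Pow U" using insert.prems by (auto simp: trace_off_def)
      ultimately obtain D where D: "D \<subseteq> U" "card D = d" "shatters (trace_off x F) D"
        using insert.IH[of "trace_off x F" d] Suc by blast
      then have "x \<notin> D" using insert.hyps by auto
      then have "(X - {x}) \<inter> D = X \<inter> D" for X by auto
      then have "shatters F D" using D(3) by (simp add: shatters_def trace_off_def)
      with D show ?thesis by blast
    next
      assume "card (upper_levels U e) < card (doubled x F)"
      moreover have "doubled x F \<subseteq> Pow U" using insert.prems by (auto simp: doubled_def)
      ultimately obtain D where D: "D \<subseteq> U" "card D = e" "shatters (doubled x F) D"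
        using insert.IH[of "doubled x F" e] by blast
      then have xD: "x \<notin> D" "finite D" using insert.hyps finite_subset by auto
      have "shatters F (insert x D)"
        unfolding shatters_def
      proof (intro allI impI)
        fix S assume "S \<subseteq> insert x D"
        then have "S - {x} \<subseteq> D" by auto
        then obtain X where X: "X \<in> doubled x F" "X \<inter> D = S - {x}"
          using D(3) unfolding shatters_def by blast
        show "\<exists>X\<in>F. X \<inter> insert x D = S"
        proof (cases "x \<in> S")
          case True
          then show ?thesis using X by (intro bexI[of _ "insert x X"]) (auto simp: doubled_def)
        next
          case False
          then show ?thesis using X by (intro bexI[of _ X]) (auto simp: doubled_def)
        qed
      qed
      moreover have "card (insert x D) = d" "insert x D \<subseteq> insert x U" using D xD Suc by auto
      ultimately show ?thesis by blast
    qed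
  qed
qed

lemma union_closed_insert_Union:
  assumes "union_closed F" "A \<in> F" "finite E" "\<And>x. x \<in> E \<Longrightarrow> g x \<in> F"
  shows "A \<union> \<Union>(g ` E) \<in> F"
  using assms(3,4)
proof (induction E rule: finite_induct)
  case (insert e E)
  then have "A \<union> \<Union>(g ` E) \<in> F" "g e \<in> F" by auto
  then have "g e \<union> (A \<union> \<Union>(g ` E)) \<in> F" using assms(1) by (simp add: union_closed_def)
  moreover have "g e \<union> (A \<union> \<Union>(g ` E)) = A \<union> \<Union>(g ` insert e E)" by auto
  ultimately show ?case by simp
qed (use assms in auto)

text \<open>Below a member with empty trace on \<open>D\<close> every member has empty trace, so the bottom \<open>Y {}\<close> can be
  taken minimal in \<open>F\<close>.\<close>

lemma shatters_imp_cube: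
  assumes "union_closed F" "shatters F D" "finite D" "finite F"
  obtains Y where "\<forall>E\<subseteq>D. Y E \<in> F \<and> Y E \<inter> D = E" "mono Y" "\<forall>B\<in>F. \<not> B \<subset> Y {}"
proof -
  have "\<forall>x\<in>D. \<exists>X\<in>F. X \<inter> D = {x}" using assms(2) by (auto simp: shatters_def)
  then obtain g where g: "\<And>x. x \<in> D \<Longrightarrow> g x \<in> F \<and> g x \<inter> D = {x}" by metis
  obtain A' where A': "A' \<in> F" "A' \<inter> D = {}" using assms(2) by (auto simp: shatters_def)
  obtain A where A: "A \<in> F" "A \<subseteq> A'" "\<forall>B\<in>F. B \<subseteq> A \<longrightarrow> A = B"
    using finite_has_minimal2[OF \<open>finite F\<close> A'(1)] by blast
  show thesis
  proof (rule that[of "\<lambda>E. A \<union> \<Union>(g ` E)"])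
    have "A \<union> \<Union>(g ` E) \<in> F" if "E \<subseteq> D" for E
      using finite_subset[OF that \<open>finite D\<close>] that g A
      by (intro union_closed_insert_Union assms) auto
    moreover have "(A \<union> \<Union>(g ` E)) \<inter> D = E" if "E \<subseteq> D" for E
    proof -
      have "(A \<union> \<Union>(g ` E)) \<inter> D = (A \<inter> D) \<union> (\<Union>x\<in>E. g x \<inter> D)" by blast
      also have "A \<inter> D = {}" using A(2) A'(2) by blast
      also have "(\<Union>x\<in>E. g x \<inter> D) = (\<Union>x\<in>E. {x})" using g that by (intro SUP_cong) auto
      finally show ?thesis by simp
    qed
    ultimately show "\<forall>E\<subseteq>D. A \<union> \<Union>(g ` E) \<in> F \<and> (A \<union> \<Union>(g ` E)) \<inter> D = E" by blast
    show "mono (\<lambda>E. A \<union> \<Union>(g ` E))" by (rule monoI) blast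
    show "\<forall>B\<in>F. \<not> B \<subset> A \<union> \<Union>(g ` {})" using A(3) by auto
  qed
qed

section \<open>Union-closed families of bounded height\<close>

text \<open>Adding the elements of \<open>E\<close> one by one climbs through the cube; the traces
  on \<open>D\<close> differ at each step, so the inclusions are strict.\<close>

lemma cube_imp_rank_ge:
  assumes "finite E" "E \<subseteq> D" "\<forall>E\<subseteq>D. Y E \<in> F \<and> Y E \<inter> D = E" "mono Y"
  shows "rank_ge F (card E) (Y E)"
  using assms(1,2)
proof (induction E rule: finite_induct)
  case empty
  then show ?case using assms(3) by simp
next
  case (insert e E)
  then have "Y E \<inter> D = E" "Y (insert e E) \<inter> D = insert e E" "Y (insert e E) \<in> F"
    using assms(3) by auto
  moreover have "Y E \<subseteq> Y (insert e E)" by (rule monoD[OF assms(4)]) auto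
  ultimately have "Y E \<subset> Y (insert e E)" using \<open>e \<notin> E\<close> by auto
  then show ?case using insert \<open>Y (insert e E) \<in> F\<close> by auto
qed

text \<open>A larger family would shatter a \<open>d\<close>-set, and the resulting cube contains a
  chain with \<open>d + 1\<close> members.\<close>

lemma card_le_upper_levels:
  assumes "finite U" "F \<subseteq> Pow U" "union_closed F" "\<nexists>X. rank_ge F d X"
  shows "card F \<le> card (upper_levels U d)"
proof (rule ccontr)
  assume "\<not> ?thesis"
  then obtain D where D: "D \<subseteq> U" "card D = d" "shatters F D"
    using sauer_shelah assms by (metis not_le)
  have fin: "finite D" "finite F"
    using D assms(1,2) by (meson finite_subset finite_Pow_iff)+
  obtain Y where Y: "\<forall>E\<subseteq>D. Y E \<in> F \<and> Y E \<inter> D = E" "mono Y" "\<forall>B\<in>F. \<not> B \<subset> Y {}"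
    by (rule shatters_imp_cube[OF assms(3) D(3) fin])
  from cube_imp_rank_ge[OF fin(1) subset_refl Y(1,2)] assms(4) D(2) show False by blast
qed

text \<open>Arbitrary preimages of a chain in the trace need not be nested. Replacing each by its
  union with the preimage chosen below it restores nesting and leaves the trace unchanged.\<close>

lemma rank_ge_trace_off:
  assumes "union_closed F" "rank_ge (trace_off x F) i X"
  shows "\<exists>X'. rank_ge F i X' \<and> X' - {x} = X"
  using assms(2)
proof (induction i arbitrary: X)
  case 0
  then show ?case by (auto simp: trace_off_def)
next
  case (Suc i)
  then obtain Y where Y: "Y \<subset> X" "rank_ge (trace_off x F) i Y" by auto
  with Suc.IH obtain Y' where Y': "rank_ge F i Y'" "Y' - {x} = Y" by blast
  obtain Z where Z: "Z \<in> F" "X = Z - {x}"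
    using rank_ge_mem[OF Suc.prems] by (auto simp: trace_off_def)
  have "Y' \<union> Z \<in> F" using Z rank_ge_mem[OF Y'(1)] assms(1) by (simp add: union_closed_def)
  moreover have "(Y' \<union> Z) - {x} = X" using Y Y' Z by auto
  moreover from this have "Y' \<subset> Y' \<union> Z" using Y Y' by auto
  ultimately show ?case using Y'(1) by (intro exI[of _ "Y' \<union> Z"]) auto
qed

text \<open>A chain in the doubled family is a chain in \<open>F\<close>, and
  \<open>insert x X\<close> can be put on top of it.\<close>

lemma rank_ge_doubled:
  assumes "rank_ge (doubled x F) i X"
  shows "rank_ge F (Suc i) (insert x X)"
proof -
  have "X \<in> doubled x F" using assms by (rule rank_ge_mem)
  moreover have "rank_ge F i X" using assms by (rule rank_ge_mono) (auto simp: doubled_def)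
  ultimately show ?thesis by (auto simp: doubled_def)
qed

lemma union_closed_trace_off: "union_closed F \<Longrightarrow> union_closed (trace_off x F)"
  by (auto simp: union_closed_def trace_off_def Un_Diff[symmetric])

lemma union_closed_doubled: "union_closed F \<Longrightarrow> union_closed (doubled x F)"
  unfolding union_closed_def doubled_def 
  by (simp, metis Un_insert_left Un_insert_right insert_absorb2)

lemma card_upper_levels_strict_mono:
  assumes "finite U" "d < d'" "d \<le> card U"
  shows "card (upper_levels U d) < card (upper_levels U d')"
proof -
  obtain X where "X \<subseteq> U" "card X = card U - d"
    using obtain_subset_with_card_n[of "card U - d" U] by auto
  then have "X \<in> upper_levels U d'" "X \<notin> upper_levels U d"
    using assms by (auto simp: upper_levels_def)
  then have "upper_levels U d \<subset> upper_levels U d'"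
    using upper_levels_mono[of d d' U] assms by auto
  then show ?thesis by (intro psubset_card_mono finite_upper_levels assms)
qed

text \<open>Induction on \<open>U\<close>: both families obtained by splitting off a point are extremal again, the
  doubled one with chains shorter by one since \<open>X \<subset> insert x X\<close> extends each of its chains.\<close>

lemma union_closed_height_extremal:
  assumes "finite U" "F \<subseteq> Pow U" "union_closed F" "U \<in> F" "\<nexists>X. rank_ge F d X"
    and "card (upper_levels U d) \<le> card F"
  shows "F = upper_levels U d"
proof -
  \<comment> \<open>Only the inclusion is proved by induction; equality then follows from the
    assumed size of \<open>F\<close>.\<close>
  have "F \<subseteq> upper_levels U d"
    using assms
  proof (induction U arbitrary: F d rule: finite_induct)
    case empty
    then have "d \<noteq> 0" by (metis rank_ge.simps(1))
    with empty show ?case by (auto simp: upper_levels_def)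
  next
    case (insert x U)
    have "finite F"
      using insert.prems(1) insert.hyps by (meson finite.insertI finite_Pow_iff finite_subset)
    obtain e where d: "d = Suc e"
      using insert.prems(3,4) by (metis not0_implies_Suc rank_ge.simps(1))
    have sub: "trace_off x F \<subseteq> Pow U" "doubled x F \<subseteq> Pow U"
      using insert.prems(1) by (auto simp: trace_off_def doubled_def)
    have no_rank: "\<nexists>X. rank_ge (trace_off x F) (Suc e) X" "\<nexists>X. rank_ge (doubled x F) e X"
      using insert.prems(4) rank_ge_trace_off[OF insert.prems(2)] rank_ge_doubled d by metis+
    note uc = union_closed_trace_off[OF insert.prems(2), of x]
      union_closed_doubled[OF insert.prems(2), of x]
    have "card (trace_off x F) \<le> card (upper_levels U (Suc e))"
      "card (doubled x F) \<le> card (upper_levels U e)"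
      using card_le_upper_levels insert.hyps(1) sub uc no_rank by blast+
    \<comment> \<open>The two upper bounds add up to the size assumed for \<open>F\<close>, so both
      of them are attained.\<close>
    then have large: "card (upper_levels U (Suc e)) \<le> card (trace_off x F)"
      "card (upper_levels U e) \<le> card (doubled x F)"
      using insert.prems(5)[unfolded d] card_trace_doubled[OF \<open>finite F\<close>, of x]
        card_upper_levels_insert[OF insert.hyps(1,2), of e] by linarith+
    have "U = insert x U - {x}" using insert.hyps by auto
    then have "U \<in> trace_off x F" using insert.prems(3) unfolding trace_off_def by blast
    then have trace: "trace_off x F \<subseteq> upper_levels U (Suc e)"
      using insert.IH sub(1) uc(1) no_rank(1) large(1) by blast
    show ?case
    proof
      fix X assume X: "X \<in> F"
      then have "X \<subseteq> insert x U" using insert.prems(1) by auto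
      then have "finite X" using insert.hyps(1) finite_subset by blast
      have "X - {x} \<in> upper_levels U (Suc e)" using X trace by (auto simp: trace_off_def)
      then have ge: "card U < card (X - {x}) + Suc e" by (simp add: upper_levels_def)
      have "card U < card X + e"
      proof (cases "x \<in> X")
        case True
        with \<open>finite X\<close> have "card X = Suc (card (X - {x}))" by (rule card.remove)
        with ge show ?thesis by simp
      next
        case False
        then have "X \<subseteq> U" "X - {x} = X" using \<open>X \<subseteq> insert x U\<close> by auto
        \<comment> \<open>If \<open>X\<close> avoids \<open>x\<close> and misses exactly
          \<open>e\<close> points of \<open>U\<close>, the whole interval from \<open>X\<close> to
          \<open>U\<close> turns out to lie in \<open>F\<close>. A maximal chain of it, topped by
          \<open>insert x U\<close>, is then too long.\<close>
        show ?thesis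
        proof (rule ccontr)
          assume "\<not> ?thesis"
          then have card: "card U = card X + e" using ge \<open>X - {x} = X\<close> by simp
          have "S \<in> F" if S: "X \<subseteq> S" "S \<subseteq> U" for S
          proof (cases "S = X")
            case False
            then have "e \<noteq> 0"
              using S card \<open>X \<subseteq> U\<close> insert.hyps(1) by (metis add.right_neutral card_subset_eq subset_antisym)
            \<comment> \<open>The induction hypothesis needs the top set as a member. Were it
              absent, every chain in the doubled family could be extended by two sets, the last
              being \<open>insert x U\<close>; this lowers the height bound to \<open>e'\<close> and
              makes the family too small.\<close>
            have "U \<in> doubled x F"
            proof (rule ccontr)
              assume "U \<notin> doubled x F"
              obtain e' where e': "e = Suc e'" using \<open>e \<noteq> 0\<close> not0_implies_Suc by blast
              have "\<not> rank_ge (doubled x F) e' Z" for Z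
              proof
                assume Z: "rank_ge (doubled x F) e' Z"
                then have "Z \<subset> U"
                  using rank_ge_mem[OF Z] sub(2) \<open>U \<notin> doubled x F\<close> by auto
                then have "insert x Z \<subset> insert x U" using insert.hyps(2) by auto
                then have "rank_ge F d (insert x U)"
                  using rank_ge_doubled[OF Z] insert.prems(3) d e' by auto
                then show False using insert.prems(4) by blast
              qed
              then have "card (doubled x F) \<le> card (upper_levels U e')"
                using card_le_upper_levels insert.hyps(1) sub(2) uc(2) by blast
              moreover have "card (upper_levels U e') < card (upper_levels U e)"
                using card e' insert.hyps(1) by (intro card_upper_levels_strict_mono) auto
              ultimately show False using large(2) by simp
            qed
            then have "doubled x F \<subseteq> upper_levels U e"
              using insert.IH sub(2) uc(2) no_rank(2) large(2) by blast
            then have "doubled x F = upper_levels U e"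
              using large(2) insert.hyps(1) by (intro card_seteq finite_upper_levels)
            moreover have "card X < card S"
              using S False insert.hyps(1) by (metis finite_subset psubsetI psubset_card_mono)
            then have "S \<in> upper_levels U e" using S card by (simp add: upper_levels_def)
            ultimately show ?thesis by (auto simp: doubled_def)
          qed (use X in simp)
          then have "rank_ge F e U"
            using card \<open>X \<subseteq> U\<close> insert.hyps(1) by (intro rank_ge_interval[of U X])
          moreover have "U \<subset> insert x U" using insert.hyps(2) by auto
          ultimately have "rank_ge F d (insert x U)" using insert.prems(3) d by auto
          then show False using insert.prems(4) by blast
        qed
      qed
      then show "X \<in> upper_levels (insert x U) d"
        using \<open>X \<subseteq> insert x U\<close> d insert.hyps by (simp add: upper_levels_def)
    qed
  qed
  then show ?thesis using assms by (intro card_seteq finite_upper_levels)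
qed

section \<open>Top-aligned families\<close>

text \<open>The condition of \<open>top_aligned\<close> over any ground set, without asking for a
  family with union \<open>U\<close>. It thus admits the empty family and survives the removal of a
  smallest member.\<close>

definition aligned :: "'a set \<Rightarrow> 'a set set \<Rightarrow> bool" where
  "aligned U T \<longleftrightarrow> T \<subseteq> Pow U \<and> (\<forall>X\<in>T. \<forall>Y\<in>Pow U - T. card Y \<le> card X)"

text \<open>A missing union would be no larger than \<open>X\<close>, hence equal to
  \<open>X\<close>.\<close>

lemma aligned_union_closed:
  assumes "finite U" "aligned U T"
  shows "union_closed T"
  unfolding union_closed_def
proof (intro ballI)
  fix X Y assume XY: "X \<in> T" "Y \<in> T"
  show "X \<union> Y \<in> T"
  proof (rule ccontr)
    assume "X \<union> Y \<notin> T"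
    then have "X \<union> Y \<in> Pow U - T" using XY assms(2) by (auto simp: aligned_def)
    then have "card (X \<union> Y) \<le> card X" "X \<union> Y \<subseteq> U"
      using assms(2) XY(1) by (auto simp: aligned_def)
    then have "X \<union> Y = X"
      using assms(1) by (metis card_seteq finite_subset sup_ge1)
    then show False using \<open>X \<union> Y \<notin> T\<close> XY by simp
  qed
qed

lemma aligned_top_mem:
  assumes "finite U" "aligned U T" "T \<noteq> {}"
  shows "U \<in> T"
proof (rule ccontr)
  assume "U \<notin> T"
  obtain X where X: "X \<in> T" "X \<subseteq> U" using assms(2,3) by (auto simp: aligned_def)
  then have "card U \<le> card X" using assms(2) \<open>U \<notin> T\<close> by (auto simp: aligned_def)
  then show False using X assms(1) \<open>U \<notin> T\<close> card_seteq by metis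
qed

lemma aligned_upper_levels: "aligned U (upper_levels U d)"
  by (fastforce simp: aligned_def upper_levels_def)

text \<open>If some \<open>B\<close> in these levels were missing, every member of \<open>T\<close>
  would be at least as large as \<open>B\<close>; then \<open>T\<close> would lie inside the levels
  and fill them by cardinality.\<close>

lemma aligned_supset_upper_levels:
  assumes "finite U" "aligned U T" "card (upper_levels U d) \<le> card T"
  shows "upper_levels U d \<subseteq> T"
proof (rule ccontr)
  assume "\<not> ?thesis"
  then obtain B where B: "B \<in> upper_levels U d" "B \<notin> T" by blast
  have "T \<subseteq> upper_levels U d"
  proof
    fix X assume "X \<in> T"
    then have "card B \<le> card X" "X \<subseteq> U"
      using B assms(2) by (auto simp: aligned_def upper_levels_def)
    then show "X \<in> upper_levels U d" using B(1) by (simp add: upper_levels_def)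
  qed
  then have "T = upper_levels U d"
    using assms by (intro card_seteq finite_upper_levels)
  then show False using B by simp
qed

text \<open>\<open>A\<close> is a member of least cardinality. All larger subsets of
  \<open>U\<close> belong to \<open>T\<close>, so the part above \<open>A\<close> is a full interval
  and \<open>T\<close> lies between the top \<open>d\<close> and the top \<open>d + 1\<close>
  levels.\<close>

lemma aligned_remove_smallest:
  assumes "finite U" "aligned U T" "T \<noteq> {}"
  obtains A d where "A \<in> T" "card U = card A + d" "aligned U (T - {A})" "\<forall>B\<in>T. \<not> B \<subset> A"
    "{X \<in> T. A \<subset> X} = {X. A \<subset> X \<and> X \<subseteq> U}" "card (upper_levels U d) < card T"
    "T \<subseteq> upper_levels U (Suc d)"
proof -
  have sub: "T \<subseteq> Pow U" using assms(2) by (simp add: aligned_def)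
  then have "finite T" using assms(1) by (meson finite_Pow_iff finite_subset)
  obtain A where A: "A \<in> T" "\<And>X. X \<in> T \<Longrightarrow> card A \<le> card X"
    using arg_min_if_finite[OF \<open>finite T\<close> assms(3), of card] by (metis not_le)
  have "A \<subseteq> U" using A sub by auto
  then obtain d where d: "card U = card A + d"
    using assms(1) by (metis card_mono le_iff_add)
  have large: "X \<in> T" if "X \<subseteq> U" "card A < card X" for X
    using that A(1) assms(2) unfolding aligned_def by (metis DiffI PowI not_le)
  have psub: "card X < card Y" if "X \<subset> Y" "Y \<subseteq> U" for X Y
    using that assms(1) by (meson finite_subset psubset_card_mono)
  have "upper_levels U d \<subset> T"
    using large A(1) d by (auto simp: upper_levels_def)
  then have "card (upper_levels U d) < card T"
    using \<open>finite T\<close> by (rule psubset_card_mono[rotated])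
  moreover have "aligned U (T - {A})"
    using assms(2) A by (auto simp: aligned_def)
  moreover have "\<forall>B\<in>T. \<not> B \<subset> A" using psub \<open>A \<subseteq> U\<close> A(2) by (metis not_le)
  moreover have "{X \<in> T. A \<subset> X} = {X. A \<subset> X \<and> X \<subseteq> U}" using psub large sub by blast
  moreover have "T \<subseteq> upper_levels U (Suc d)"
    using sub A(2) d by (fastforce simp: upper_levels_def)
  ultimately show thesis using A(1) d by (intro that[of A d])
qed

text \<open>Greedy construction: a largest missing set is added at each step.\<close>

lemma aligned_exists:
  assumes "finite U" "m \<le> 2 ^ card U"
  shows "\<exists>T. aligned U T \<and> card T = m"
  using assms(2)
proof (induction m)
  case 0
  show ?case by (intro exI[of _ "{}"]) (simp add: aligned_def)
next
  case (Suc m)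
  then obtain T where T: "aligned U T" "card T = m" by auto
  have "finite (Pow U - T)" using assms(1) by simp
  have sub: "T \<subseteq> Pow U" using T by (simp add: aligned_def)
  then have "finite T" using assms(1) by (meson finite_Pow_iff finite_subset)
  have "T \<noteq> Pow U" using Suc.prems T(2) assms(1) by (auto simp: card_Pow)
  then have "Pow U - T \<noteq> {}" using sub by blast
  then have "card ` (Pow U - T) \<noteq> {}" by blast
  then have "Max (card ` (Pow U - T)) \<in> card ` (Pow U - T)"
    using \<open>finite (Pow U - T)\<close> by (intro Max_in) auto
  then obtain B where B: "B \<in> Pow U - T" "card B = Max (card ` (Pow U - T))" by force
  then have "card Y \<le> card B" if "Y \<in> Pow U - T" for Y
    using that \<open>finite (Pow U - T)\<close> by simp
  then have "aligned U (insert B T)" using T B(1) by (auto simp: aligned_def)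
  moreover have "card (insert B T) = Suc m" using B T \<open>finite T\<close> by simp
  ultimately show ?case by blast
qed

text \<open>The cube \<open>Pow D\<close> provided by Sauer--Shelah embeds the interval above a set of
  codimension \<open>d\<close> into the part of \<open>F\<close> above one of its minimal members.\<close>

lemma exists_minimal_with_many_chains:
  assumes "finite U" "F \<subseteq> Pow U" "union_closed F" "card (upper_levels U d) < card F"
    and "A0 \<subseteq> U" "card U = card A0 + d"
  obtains A where "A \<in> F" "\<forall>B\<in>F. \<not> B \<subset> A"
    "card (k_chains j {X. A0 \<subset> X \<and> X \<subseteq> U}) \<le> card (k_chains j {X \<in> F. A \<subset> X})"
proof -
  obtain D where D: "D \<subseteq> U" "card D = d" "shatters F D"
    using sauer_shelah[OF assms(1,2,4)] by blast
  have fin: "finite D" "finite F" "finite A0"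
    using D assms(1,2,5) by (meson finite_subset finite_Pow_iff)+
  obtain Y where Y: "\<forall>E\<subseteq>D. Y E \<in> F \<and> Y E \<inter> D = E" "mono Y" "\<forall>B\<in>F. \<not> B \<subset> Y {}"
    by (rule shatters_imp_cube[OF assms(3) D(3) fin(1,2)])
  have strict: "Y E \<subset> Y E'" if "E \<subset> E'" "E' \<subseteq> D" for E E'
  proof -
    have "Y E \<inter> D \<noteq> Y E' \<inter> D" using Y(1) that by auto
    moreover have "Y E \<subseteq> Y E'" by (rule monoD[OF Y(2)]) (use that in auto)
    ultimately show ?thesis by auto
  qed
  have "card (U - A0) = card D"
    using assms(5,6) fin D by (simp add: card_Diff_subset)
  then obtain h where h: "bij_betw h (U - A0) D"
    using finite_same_card_bij[of "U - A0" D] assms(1) fin by auto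
  then have inj: "inj_on h (U - A0)" and img: "h ` (U - A0) = D" by (auto simp: bij_betw_def)
  \<comment> \<open>The bijection \<open>h\<close> relabels the \<open>d\<close> points outside
    \<open>A0\<close> by those of \<open>D\<close>, turning the interval above \<open>A0\<close>
    into the cube with its bottom removed.\<close>
  let ?f = "\<lambda>X. Y (h ` (X - A0))" and ?I = "{X. A0 \<subset> X \<and> X \<subseteq> U}"
  have imgD: "h ` (X - A0) \<subseteq> D" if "X \<subseteq> U" for X using that img by blast
  have mono: "h ` (X - A0) \<subset> h ` (Z - A0)" if "X \<subset> Z" "A0 \<subseteq> X" "Z \<subseteq> U" for X Z
    using that by (intro image_strict_mono inj_on_subset[OF inj]) auto
  show thesis
  proof (rule that[of "Y {}"])
    show "card (k_chains j ?I) \<le> card (k_chains j {X \<in> F. Y {} \<subset> X})"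
    proof (rule card_k_chains_embedding(1)[where f = ?f])
      show "?f X \<in> {X \<in> F. Y {} \<subset> X}" if "X \<in> ?I" for X
        using that imgD[of X] mono[of A0 X] Y(1) by (auto intro!: strict)
      show "?f X \<subset> ?f Z" if "X \<in> ?I" "Z \<in> ?I" "X \<subset> Z" for X Z
        using that imgD[of Z] mono[of X Z] by (intro strict) auto
      show "inj_on ?f ?I"
      proof (rule inj_onI)
        fix X Z assume XZ: "X \<in> ?I" "Z \<in> ?I" "?f X = ?f Z"
        then have "h ` (X - A0) = h ` (Z - A0)"
          using Y(1) imgD[of X] imgD[of Z] by (metis (mono_tags, lifting) mem_Collect_eq)
        then have "X - A0 = Z - A0"
          using XZ by (subst (asm) inj_on_image_eq_iff[OF inj]) auto
        then show "X = Z" using XZ by auto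
      qed
    qed (use fin in simp)
  qed (use Y in auto)
qed

section \<open>Aligned families minimize the number of chains\<close>

text \<open>Stated for subfamilies of \<open>Pow U\<close> so that it survives the removal of a
  member on either side.\<close>

lemma aligned_minimizes_k_chains:
  assumes "finite U" "aligned U T" "F \<subseteq> Pow U" "union_closed F" "card T = card F"
  shows "card (k_chains (Suc j) T) \<le> card (k_chains (Suc j) F)"
  using assms(2-)
proof (induction "card F" arbitrary: F T)
  case 0
  have "T \<subseteq> Pow U" using 0 by (simp add: aligned_def)
  then have "T = {}" "F = {}"
    using 0 assms(1) by (metis card_0_eq finite_Pow_iff finite_subset)+
  then show ?case by simp
next
  case (Suc m)
  have fin: "finite F" "finite T" using Suc by (metis Suc_neq_Zero card.infinite)+
  have "T \<noteq> {}" using Suc by auto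
  then obtain A0 d where A0: "A0 \<in> T" "card U = card A0 + d" "aligned U (T - {A0})"
      "\<forall>B\<in>T. \<not> B \<subset> A0" "{X \<in> T. A0 \<subset> X} = {X. A0 \<subset> X \<and> X \<subseteq> U}"
      "card (upper_levels U d) < card T" "T \<subseteq> upper_levels U (Suc d)"
    by (rule aligned_remove_smallest[OF assms(1) Suc.prems(1)])
  have "A0 \<subseteq> U" using A0(1) Suc.prems(1) by (auto simp: aligned_def)
  obtain A where A: "A \<in> F" "\<forall>B\<in>F. \<not> B \<subset> A"
    "card (k_chains j {X. A0 \<subset> X \<and> X \<subseteq> U}) \<le> card (k_chains j {X \<in> F. A \<subset> X})"
    by (rule exists_minimal_with_many_chains[OF assms(1) Suc.prems(2,3)
          A0(6)[unfolded Suc.prems(4)] \<open>A0 \<subseteq> U\<close> A0(2)])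
  have "card (k_chains (Suc j) (T - {A0})) \<le> card (k_chains (Suc j) (F - {A}))"
    using Suc A A0 fin by (intro Suc.hyps(1) union_closed_remove_minimal) auto
  then show ?case
    using card_k_chains_remove_minimal[OF fin(2) A0(1,4), of j]
      card_k_chains_remove_minimal[OF fin(1) A(1,2), of j] A(3) A0(5) by simp
qed

section \<open>Strict inequality for families that are not aligned\<close>

text \<open>Supplies the strict gain when the removed set is too small: \<open>F\<close> contains
  every set larger than \<open>A0\<close>, so above \<open>A\<close> there is room for a copy of the
  interval above \<open>A0\<close> and for a further chain of length \<open>j\<close>.\<close>

lemma more_chains_above_smaller_set:
  assumes "finite U" "F \<subseteq> Pow U" "upper_levels U d \<subseteq> F" "A0 \<subseteq> U" "card U = card A0 + d"
    and "A \<subseteq> U" "card A < card A0" "2 \<le> d" "1 \<le> j" "j \<le> d"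
  shows "card (k_chains j {X. A0 \<subset> X \<and> X \<subseteq> U}) < card (k_chains j {X \<in> F. A \<subset> X})"
proof -
  let ?I = "{X. A0 \<subset> X \<and> X \<subseteq> U}" and ?G = "{X \<in> F. A \<subset> X}"
  have fin: "finite F" "finite A0" "finite A"
    using assms(1,2,4,6) by (meson finite_subset finite_Pow_iff)+
  have "d \<le> card (U - A)"
    using assms(5-7) fin by (simp add: card_Diff_subset)
  then obtain D where D: "D \<subseteq> U - A" "card D = d" "finite D"
    by (rule obtain_subset_with_card_n)
  \<comment> \<open>The interval above \<open>R \<supset> A\<close> already has as many chains as the one above \<open>A0\<close>, and it
    misses every chain through \<open>U - {y}\<close>, where \<open>y \<in> R - A\<close>.\<close>
  define R where "R = U - D"
  have "D \<subseteq> U" using D(1) by auto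
  then have "card R = card A0" unfolding R_def using assms(5) D by (simp add: card_Diff_subset)
  have "A \<subseteq> R" and "R \<subseteq> U" unfolding R_def using assms(6) D(1) by auto
  then have "\<not> R \<subseteq> A" 
    using assms(7) fin(3) \<open>card R = card A0\<close> by (metis card_mono not_le)
  then obtain y where y: "y \<in> R" "y \<notin> A" by blast
  have inG: "X \<in> ?G" if "A \<subseteq> X" "X \<subseteq> U" "card A0 < card X" for X
    using that assms(3,5,7) by (auto simp: upper_levels_def)
  have "card (U - A0) = card D"
    using assms(4,5) fin D by (simp add: card_Diff_subset)
  then obtain h where h: "bij_betw h (U - A0) D"
    using finite_same_card_bij[of "U - A0" D] assms(1) D(3) by auto
  then have inj: "inj_on h (U - A0)" and img: "h ` (U - A0) = D" by (auto simp: bij_betw_def)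
  let ?f = "\<lambda>X. R \<union> h ` (X - A0)"
  have imgD: "h ` (X - A0) \<subseteq> D" if "X \<subseteq> U" for X using that img by blast
  have strict: "?f X \<subset> ?f Z" if "X \<subset> Z" "A0 \<subseteq> X" "Z \<subseteq> U" for X Z
  proof -
    have "h ` (X - A0) \<subset> h ` (Z - A0)"
      using that by (intro image_strict_mono inj_on_subset[OF inj]) auto
    then show ?thesis using imgD[of Z] that unfolding R_def by blast
  qed
  have fU: "?f X \<subseteq> U" if "X \<subseteq> U" for X using imgD[OF that] D(1) \<open>R \<subseteq> U\<close> by blast
  \<comment> \<open>The size makes \<open>A \<union> R'\<close> have \<open>card A0 + 1\<close>
    elements, the least size guaranteed to lie in \<open>F\<close>. From there to
    \<open>U - {y}\<close> are \<open>d - 2\<close> steps, hence \<open>d - 1\<close> sets, and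
    \<open>U\<close> becomes the \<open>d\<close>-th.\<close>
  obtain R' where R': "R' \<subseteq> U - {y} - A" "card R' = card (U - {y} - A) - (d - 2)"
    using obtain_subset_with_card_n[of "card (U - {y} - A) - (d - 2)" "U - {y} - A"] by auto
  have "card (U - {y}) = card A0 + d - 1"
    using y \<open>R \<subseteq> U\<close> assms(1,5) by auto
  moreover from this have "card (U - {y} - A) = card A0 + d - 1 - card A"
    using y assms(6) fin(3) by (subst card_Diff_subset) auto
  moreover have "card (A \<union> R') = card A + card R'"
    using R'(1) fin(3) finite_subset[OF R'(1)] assms(1) by (intro card_Un_disjoint) auto
  ultimately have card_y: "card (A \<union> R') = card A0 + 1" "card (U - {y}) = card (A \<union> R') + (d - 2)"
    using R'(2) assms(7,8) by linarith+
  have rank: "rank_ge ?G (d - 2) (U - {y})"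
  proof (rule rank_ge_interval[OF _ _ card_y(2)])
    fix S assume S: "A \<union> R' \<subseteq> S" "S \<subseteq> U - {y}"
    then have "card (A \<union> R') \<le> card S"
      using assms(1) by (meson card_mono finite_Diff finite_subset)
    with S card_y(1) show "S \<in> ?G" by (intro inG) auto
  qed (use assms(1,6) R' y in auto)
  have "U \<in> ?G"
    using assms(5,6,8) by (intro inG) auto
  obtain C0 where C0: "C0 \<in> k_chains (Suc (d - 2)) ?G" "U - {y} \<in> C0" "\<forall>Z\<in>C0. Z \<subseteq> U - {y}"
    using rank_ge_imp_chain[OF rank] by blast
  then have "U \<notin> C0" "\<forall>Z\<in>C0. Z \<subseteq> U" using y \<open>R \<subseteq> U\<close> by auto
  define C where "C = insert U C0"
  have C: "C \<in> k_chains (Suc (Suc (d - 2))) (insert U ?G)" "U - {y} \<in> C"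
    unfolding C_def using C0(1,2) \<open>U \<notin> C0\<close> \<open>\<forall>Z\<in>C0. Z \<subseteq> U\<close> unfolding k_chains_iff by auto
  then have C': "finite C" "card C = d" "C \<subseteq> ?G" "\<forall>X\<in>C. \<forall>Y\<in>C. X \<subseteq> Y \<or> Y \<subseteq> X"
    using \<open>U \<in> ?G\<close> assms(8) unfolding k_chains_iff by auto
  \<comment> \<open>The chain of length \<open>d\<close> is thinned to length \<open>j\<close>,
    keeping \<open>U - {y}\<close>.\<close>
  have "j - 1 \<le> card (C - {U - {y}})" using C(2) C' assms(10) by simp
  then obtain B where B: "B \<subseteq> C - {U - {y}}" "card B = j - 1" "finite B"
    by (rule obtain_subset_with_card_n)
  have "U - {y} \<notin> B" using B by auto
  then have "card (insert (U - {y}) B) = j" using B assms(9) by simp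
  then have chain: "insert (U - {y}) B \<in> k_chains j ?G"
  proof -
    have "insert (U - {y}) B \<subseteq> C" using B(1) C(2) by auto
    with C'(3,4) B(3) \<open>card _ = j\<close> show ?thesis
      unfolding k_chains_iff by (meson finite.insertI subset_iff)
  qed
  show ?thesis
  proof (rule card_k_chains_embedding(2)[where f = ?f and C = "insert (U - {y}) B"])
    show "?f X \<in> ?G" if "X \<in> ?I" for X
    proof (rule inG)
      have "R \<subset> ?f X" using strict[of A0 X] that by auto
      then show "card A0 < card (?f X)"
        using fU[of X] that assms(1) \<open>card R = card A0\<close>
        by (metis (mono_tags, lifting) finite_subset mem_Collect_eq psubset_card_mono)
      show "?f X \<subseteq> U" using fU[of X] that by simp
      show "A \<subseteq> ?f X" using \<open>A \<subseteq> R\<close> by (rule le_supI1)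
    qed
    show "inj_on ?f ?I"
    proof (rule inj_onI)
      fix X Z assume XZ: "X \<in> ?I" "Z \<in> ?I" "?f X = ?f Z"
      have "?f X - R = h ` (X - A0)" if "X \<subseteq> U" for X
        using imgD[OF that] unfolding R_def by auto
      with XZ have "h ` (X - A0) = h ` (Z - A0)"
        by (metis (mono_tags, lifting) mem_Collect_eq)
      then have "X - A0 = Z - A0"
        using XZ by (subst (asm) inj_on_image_eq_iff[OF inj]) auto
      then show "X = Z" using XZ by auto
    qed
    \<comment> \<open>Every value of \<open>?f\<close> contains \<open>R\<close> and therefore
      \<open>y\<close>.\<close>
    show "\<not> insert (U - {y}) B \<subseteq> ?f ` ?I" using y(1) by auto
    show "?f X \<subset> ?f Z" if "X \<in> ?I" "Z \<in> ?I" "X \<subset> Z" for X Z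
      using that by (intro strict) auto
    show "finite ?G" using fin(1) by simp
  qed (rule chain)
qed

text \<open>The pairs \<open>{X, U}\<close> already use up all the 2-chains allowed. A chain of
  three members would give a pair avoiding \<open>U\<close>, so \<open>F\<close> has height at most
  two and is extremal for its size.\<close>

lemma aligned_of_few_2_chains:
  assumes "finite U" "F \<subseteq> Pow U" "union_closed F" "U \<in> F" "card F = card U + 1"
    and "card (k_chains 2 F) \<le> card U"
  shows "aligned U F"
proof -
  have "finite F" using assms(1,2) by (meson finite_Pow_iff finite_subset)
  let ?S = "(\<lambda>X. {X, U}) ` (F - {U})"
  have "{X, U} \<in> k_chains 2 F" if "X \<in> F - {U}" for X
  proof -
    have "X \<subseteq> U" "X \<noteq> U" using that assms(2) by auto
    then show ?thesis using that assms(4) by (simp add: k_chains_iff card_insert_if)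
  qed
  then have "?S \<subseteq> k_chains 2 F" by blast
  moreover have "card ?S = card (F - {U})"
    by (intro card_image inj_onI) (auto simp: doubleton_eq_iff)
  ultimately have S: "?S = k_chains 2 F"
    using assms(4-6) by (intro card_seteq finite_k_chains \<open>finite F\<close>) auto
  have "\<not> rank_ge F 2 X" for X
  proof
    assume "rank_ge F 2 X"
    then obtain Y Z where YZ: "X \<in> F" "Y \<in> F" "Z \<in> F" "Z \<subset> Y" "Y \<subset> X"
      by (auto simp: numeral_2_eq_2)
    then have "{Z, Y} \<in> k_chains 2 F" by (auto simp: k_chains_iff)
    then have "U \<in> {Z, Y}" unfolding S[symmetric] by auto
    then show False using YZ assms(2) by blast
  qed
  then have "F = upper_levels U 2"
    using assms by (intro union_closed_height_extremal) (simp_all add: card_upper_levels_2)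
  then show ?thesis by (simp add: aligned_upper_levels)
qed

text \<open>Within the top two levels a strict inclusion can only end at \<open>U\<close>.\<close>

lemma card_2_chains_le:
  assumes "finite U" "F \<subseteq> upper_levels U 2"
  shows "card (k_chains 2 F) \<le> card (F - {U})"
proof -
  have "finite F" using finite_upper_levels[OF assms(1)] assms(2) by (rule finite_subset[rotated])
  have top: "Y = U" if "X \<in> F" "Y \<in> F" "X \<subset> Y" for X Y
  proof -
    have XY: "X \<subseteq> U" "Y \<subseteq> U" "card U < card X + 2"
      using that assms(2) by (auto simp: upper_levels_def)
    then have "card X < card Y" using that(3) assms(1) by (meson finite_subset psubset_card_mono)
    then show ?thesis using XY assms(1) by (intro card_seteq) auto
  qed
  have "k_chains 2 F \<subseteq> (\<lambda>X. {X, U}) ` (F - {U})"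
  proof
    fix C assume C: "C \<in> k_chains 2 F"
    then obtain X Y where XY: "C = {X, Y}" "X \<noteq> Y" by (auto simp: k_chains_iff card_2_iff)
    with C have "X \<in> F" "Y \<in> F" "X \<subset> Y \<or> Y \<subset> X" by (auto simp: k_chains_iff)
    with top XY show "C \<in> (\<lambda>X. {X, U}) ` (F - {U})" by (metis DiffI imageI insert_commute singletonD)
  qed
  then show ?thesis using \<open>finite F\<close> by (meson card_image_le card_mono finite_Diff finite_imageI le_trans)
qed

text \<open>Members of a chain have distinct sizes, and at most \<open>d\<close> sizes occur in
  these levels.\<close>

lemma k_le_of_chain_in_upper_levels:
  assumes "finite U" "F \<subseteq> upper_levels U d" "k_chains k F \<noteq> {}"
  shows "k \<le> d"
proof -
  obtain C where C: "C \<in> k_chains k F" using assms(3) by blast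
  then have sub: "C \<subseteq> upper_levels U d" using assms(2) by (auto simp: k_chains_iff)
  have fin: "finite X" if "X \<in> C" for X
    using that sub assms(1) unfolding upper_levels_def
    by (metis (mono_tags, lifting) finite_subset mem_Collect_eq subsetD)
  have "inj_on card C"
  proof (rule inj_onI)
    fix X Y assume XY: "X \<in> C" "Y \<in> C" "card X = card Y"
    then have "X \<subseteq> Y \<or> Y \<subseteq> X" using C by (auto simp: k_chains_iff)
    then show "X = Y" using XY fin by (metis card_subset_eq)
  qed
  then have "k = card (card ` C)" using C by (simp add: card_image k_chains_iff)
  moreover have "card ` C \<subseteq> {Suc (card U) - d..card U}"
    using sub assms(1) by (fastforce simp: upper_levels_def intro: card_mono)
  then have "card (card ` C) \<le> card {Suc (card U) - d..card U}" by (intro card_mono) auto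
  ultimately show ?thesis by simp
qed

lemma not_aligned_imp_more_k_chains:
  assumes "finite U" "aligned U T" "F \<subseteq> Pow U" "union_closed F" "card T = card F" "U \<in> F"
    and "\<not> aligned U F" "card U < card F" "k_chains (Suc j) T \<noteq> {}" "1 \<le> j"
  shows "card (k_chains (Suc j) T) < card (k_chains (Suc j) F)"
  using assms(2-9)
proof (induction "card F" arbitrary: F T)
  case 0
  then have "card U < 0" by presburger
  then show ?case by simp
next
  case (Suc m)
  have fin: "finite F" "finite T" using Suc.hyps(2) Suc.prems(4) by (metis Suc_neq_Zero card.infinite)+
  have "T \<noteq> {}" using Suc.prems(4) Suc.hyps(2) by auto
  then obtain A0 d where A0: "A0 \<in> T" "card U = card A0 + d" "aligned U (T - {A0})"
      "\<forall>B\<in>T. \<not> B \<subset> A0" "{X \<in> T. A0 \<subset> X} = {X. A0 \<subset> X \<and> X \<subseteq> U}"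
      "card (upper_levels U d) < card T" "T \<subseteq> upper_levels U (Suc d)"
    by (rule aligned_remove_smallest[OF assms(1) Suc.prems(1)])
  have "A0 \<subseteq> U" using A0(1) Suc.prems(1) by (auto simp: aligned_def)
  \<comment> \<open>This is where the existence of a long chain in \<open>T\<close> enters:
    \<open>T\<close> lies in the top \<open>d + 1\<close> levels.\<close>
  have "j \<le> d" using k_le_of_chain_in_upper_levels[OF assms(1) A0(7) Suc.prems(8)] by simp
  show ?case
  proof (cases "card F = card U + 1")
    \<comment> \<open>The smallest size covered, where removing a member would leave too few for the
      induction hypothesis. Here \<open>d = 1\<close> and \<open>j = 1\<close>, and 2-chains are
      counted directly.\<close>
    case True
    have "card (upper_levels U d) < card (upper_levels U 2)"
      using A0(6) True Suc.prems(4) card_upper_levels_2[OF assms(1)] by simp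
    then have "d < 2"
      using card_mono[OF finite_upper_levels[OF assms(1)] upper_levels_mono] by (metis not_le)
    then have "d = 1" "j = 1" using \<open>j \<le> d\<close> assms(10) by auto
    then have "card (k_chains 2 T) \<le> card (T - {U})"
      using card_2_chains_le[OF assms(1)] A0(7) by (simp add: numeral_2_eq_2)
    also have "\<dots> = card U"
      using aligned_top_mem[OF assms(1) Suc.prems(1) \<open>T \<noteq> {}\<close>] Suc.prems(4) True by simp
    also have "\<dots> < card (k_chains 2 F)"
      using aligned_of_few_2_chains[OF assms(1) Suc.prems(2,3,5) True] Suc.prems(6) by linarith
    finally show ?thesis using \<open>j = 1\<close> by (simp add: numeral_2_eq_2)
  next
    case False
    then have large: "card U + 1 < card F" using Suc.prems(7) by simp
    have "2 \<le> d"
    proof (rule ccontr)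
      assume "\<not> ?thesis"
      then have "T \<subseteq> upper_levels U 2"
        using A0(7) upper_levels_mono[of "Suc d" 2 U] by auto
      then have "card T \<le> card U + 1"
        using card_mono[OF finite_upper_levels] card_upper_levels_2 assms(1) by metis
      then show False using large Suc.prems(4) by simp
    qed
    obtain A where A: "A \<in> F" "\<forall>B\<in>F. \<not> B \<subset> A"
      "card (k_chains j {X. A0 \<subset> X \<and> X \<subseteq> U}) \<le> card (k_chains j {X \<in> F. A \<subset> X})"
      by (rule exists_minimal_with_many_chains[OF assms(1) Suc.prems(2,3)
            A0(6)[unfolded Suc.prems(4)] \<open>A0 \<subseteq> U\<close> A0(2)])
    have "A \<subseteq> U" using A(1) Suc.prems(2) by auto
    \<comment> \<open>The top set must stay in the family for the induction hypothesis and the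
      extremal result.\<close>
    have "A \<noteq> U"
    proof
      assume "A = U"
      then have "F \<subseteq> {U}" using A(2) Suc.prems(2) by blast
      then show False using large card_mono[of "{U}" F] by simp
    qed
    let ?T = "T - {A0}" and ?F = "F - {A}"
    have cards: "Suc (card ?F) = card F" "Suc (card ?T) = card T"
      using card_Suc_Diff1 fin A(1) A0(1) by metis+
    have F': "?F \<subseteq> Pow U" "union_closed ?F" "card ?T = card ?F" "U \<in> ?F" "card U < card ?F"
        "m = card ?F" "card (upper_levels U d) \<le> card ?F"
      using Suc.prems(2,4,5) Suc.hyps(2) A0(6) \<open>A \<noteq> U\<close> large cards
        union_closed_remove_minimal[OF Suc.prems(3) A(2)] by auto
    have le: "card (k_chains (Suc j) ?T) \<le> card (k_chains (Suc j) ?F)"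
      by (rule aligned_minimizes_k_chains[OF assms(1) A0(3) F'(1-3)])
    have rec: "card (k_chains (Suc j) T) =
        card (k_chains (Suc j) ?T) + card (k_chains j {X. A0 \<subset> X \<and> X \<subseteq> U})"
      "card (k_chains (Suc j) F) =
        card (k_chains (Suc j) ?F) + card (k_chains j {X \<in> F. A \<subset> X})"
      by (rule card_k_chains_remove_minimal[OF fin(2) A0(1,4), unfolded A0(5)],
          rule card_k_chains_remove_minimal[OF fin(1) A(1,2)])
    show ?thesis
    proof (cases "aligned U ?F")
      case True
      have upper: "upper_levels U d \<subseteq> ?F"
        by (rule aligned_supset_upper_levels[OF assms(1) True F'(7)])
      then have upper_F: "upper_levels U d \<subseteq> F" by blast
      \<comment> \<open>Sets larger than \<open>A0\<close> all lie in \<open>F - {A}\<close>. If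
        \<open>A\<close> were at least as large as \<open>A0\<close>, putting it back would keep the
        family aligned.\<close>
      have less: "card A < card A0"
      proof (rule ccontr)
        assume smaller: "\<not> ?thesis"
        have le_A0: "card Y \<le> card A0" if "Y \<in> Pow U - F" for Y
        proof (rule ccontr)
          assume "\<not> ?thesis"
          then have "Y \<in> upper_levels U d" using that A0(2) by (simp add: upper_levels_def)
          then show False using that upper by auto
        qed
        have "card Y \<le> card X" if "X \<in> F" "Y \<in> Pow U - F" for X Y
        proof (cases "X = A")
          case True
          then show ?thesis using le_A0[OF that(2)] smaller by simp
        next
          case False
          then have "X \<in> ?F" "Y \<in> Pow U - ?F" using that by auto
          then show ?thesis using True unfolding aligned_def by blast
        qed
        then have "aligned U F" using Suc.prems(2) unfolding aligned_def by blast
        then show False using Suc.prems(6) by contradiction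
      qed
      have "card (k_chains j {X. A0 \<subset> X \<and> X \<subseteq> U}) < card (k_chains j {X \<in> F. A \<subset> X})"
        by (rule more_chains_above_smaller_set[OF assms(1) Suc.prems(2) upper_F \<open>A0 \<subseteq> U\<close>
              A0(2) \<open>A \<subseteq> U\<close> less \<open>2 \<le> d\<close> assms(10) \<open>j \<le> d\<close>])
      with le rec show ?thesis by simp
    next
      case False
      have "card (k_chains (Suc j) ?T) < card (k_chains (Suc j) ?F)"
      proof (cases "k_chains (Suc j) ?T = {}")
        case True
        \<comment> \<open>With no chain left in \<open>?T\<close>, a single one in \<open>?F\<close>
          suffices. Without a chain of \<open>d + 1\<close> members, \<open>?F\<close> would be
          extremal for its height and hence aligned.\<close>
        have "\<exists>X. rank_ge ?F d X"
        proof (rule ccontr)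
          assume "\<not> ?thesis"
          from union_closed_height_extremal[OF assms(1) F'(1,2,4) this F'(7)]
          show False using \<open>\<not> aligned U ?F\<close> by (simp add: aligned_upper_levels)
        qed
        then obtain X where "rank_ge ?F j X" using rank_ge_le[OF _ \<open>j \<le> d\<close>] by metis
        then obtain C where "C \<in> k_chains (Suc j) ?F" by (blast dest: rank_ge_imp_chain)
        then have "card (k_chains (Suc j) ?F) \<noteq> 0"
          using fin(1) finite_k_chains[of ?F "Suc j"] by auto
        then show ?thesis using True by simp
      next
        case nonempty: False
        show ?thesis
          by (rule Suc.hyps(1)[OF F'(6) A0(3) F'(1-4) False F'(5) nonempty])
      qed
      with A(3) rec show ?thesis by simp
    qed
  qed
qed

section \<open>Transfer to union-closed families with universe \<open>{1..n}\<close>\<close>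

lemma union_closed_Union_mem:
  assumes "union_closed F" "finite F" "F \<noteq> {}"
  shows "\<Union>F \<in> F"
proof -
  obtain A where A: "A \<in> F" using assms(3) by blast
  have "A \<union> \<Union>((\<lambda>X. X) ` F) \<in> F" by (rule union_closed_insert_Union[OF assms(1) A assms(2)])
  moreover have "A \<union> \<Union>((\<lambda>X. X) ` F) = \<Union>F" using A by auto
  ultimately show ?thesis by simp
qed

lemma uc_familiesD:
  assumes "F \<in> uc_families n m"
  shows "F \<subseteq> Pow {1..n}" "union_closed F" "card F = m" "{1..n} \<in> F"
proof -
  show "F \<subseteq> Pow {1..n}" "union_closed F" "card F = m"
    using assms by (auto simp: uc_families_def)
  have "\<Union>F \<in> F"
    using assms by (intro union_closed_Union_mem) (auto simp: uc_families_def is_family_def)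
  then show "{1..n} \<in> F" using assms by (simp add: uc_families_def)
qed

lemma top_aligned_iff:
  assumes "F \<in> uc_families n m"
  shows "top_aligned n F \<longleftrightarrow> aligned {1..n} F"
  using assms uc_familiesD(1)[OF assms]
  by (auto simp: top_aligned_def aligned_def uc_families_def)

lemma aligned_in_uc_families:
  assumes "n \<ge> 1" "1 \<le> card T" "aligned {1..n} T"
  shows "T \<in> uc_families n (card T)"
proof -
  have T: "T \<subseteq> Pow {1..n}" using assms(3) by (simp add: aligned_def)
  have "T \<noteq> {}" using assms(2) by auto
  then have top: "{1..n} \<in> T" by (intro aligned_top_mem assms) simp
  moreover have "{1..n} \<noteq> {}" using assms(1) by simp
  ultimately have "\<exists>A\<in>T. A \<noteq> {}" by blast
  moreover have "finite T" "\<forall>A\<in>T. finite A"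
    using T by (meson finite_Pow_iff finite_atLeastAtMost finite_subset PowD subsetD)+
  ultimately have "is_family T" by (simp add: is_family_def)
  moreover have "\<Union>T = {1..n}" using T top by blast
  ultimately show ?thesis
    using aligned_union_closed[of "{1..n}" T] assms(3) by (simp add: uc_families_def)
qed

lemma min_k_chains_le:
  assumes "F \<in> uc_families n m"
  shows "min_k_chains k n m \<le> card (k_chains k F)"
proof -
  have "finite (uc_families n m)"
    by (rule finite_subset[of _ "Pow (Pow {1..n})"]) (use uc_familiesD(1) in blast, simp)
  then show ?thesis unfolding min_k_chains_def using assms by (intro Min_le) auto
qed

theorem mainTheorem1:
  fixes k n m :: nat
  assumes "n \<ge> 1" and "2 \<le> k" and "k \<le> n + 1" and "1 \<le> m" and "m \<le> 2 ^ n"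
  shows "(\<forall>\<T>\<in>uc_families n m. top_aligned n \<T> \<longrightarrow>
            (\<forall>\<A>\<in>uc_families n m. card (k_chains k \<T>) \<le> card (k_chains k \<A>)))
       \<and> (min_k_chains k n m \<noteq> 0 \<and> m > n \<longrightarrow>
            (\<forall>\<A>\<in>uc_families n m. card (k_chains k \<A>) = min_k_chains k n m \<longrightarrow> top_aligned n \<A>))"
proof (intro conjI impI ballI)
  obtain j where k: "k = Suc j" "1 \<le> j" using \<open>2 \<le> k\<close> by (cases k) auto
  show "card (k_chains k T) \<le> card (k_chains k F)"
    if "T \<in> uc_families n m" "top_aligned n T" "F \<in> uc_families n m" for T F
    unfolding k(1) using that uc_familiesD[OF that(1)] uc_familiesD[OF that(3)]
    by (intro aligned_minimizes_k_chains[of "{1..n}"]) (simp_all add: top_aligned_iff)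
  fix F assume F: "F \<in> uc_families n m"
    and min: "card (k_chains k F) = min_k_chains k n m" "min_k_chains k n m \<noteq> 0 \<and> m > n"
  \<comment> \<open>An aligned family of size \<open>m\<close> is the reference: its count is at
    least the nonzero minimum, so it has a chain of length \<open>k\<close>, and a minimizer that is
    not aligned would exceed this count.\<close>
  obtain T where T: "aligned {1..n} T" "card T = m"
    using aligned_exists[of "{1..n}" m] \<open>m \<le> 2 ^ n\<close> by auto
  then have "T \<in> uc_families n m" using aligned_in_uc_families assms(1,4) by blast
  then have le: "min_k_chains k n m \<le> card (k_chains k T)" by (rule min_k_chains_le)
  then have "k_chains k T \<noteq> {}" using min(2) by auto
  show "top_aligned n F"
  proof (rule ccontr)
    assume "\<not> top_aligned n F"
    then have "card (k_chains k T) < card (k_chains k F)"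
      unfolding k(1)
      using T F uc_familiesD[OF F] k \<open>k_chains k T \<noteq> {}\<close> min(2)
      by (intro not_aligned_imp_more_k_chains[of "{1..n}"]) (simp_all add: top_aligned_iff)
    with le min(1) show False by simp
  qed
qed

end
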